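(* Let $A$ be a random level algebra generated as follows: let $p\in(0,1)$ and $q=1-p$, let $\mathcal{B}$ be a random subset of the set $\mathrm{Mon}(n,D)$ of all monomials of degree exactly $D$ in $S=\mathbb{k}[x_1,\ldots,x_n]$, formed by including each element of $\mathrm{Mon}(n,D)$ independently with probability $p$, and set $A=S/\mathrm{Ann}(\mathcal{B})$. Let $h_j=\dim_{\mathbb{k}}[A]_j$. Then the expected Hilbert function in degree $j$ with $0\le j<D$ is $$\mathbb{E}[h_j]=\binom{j+n-1}{n-1}\left(1-q^{\binom{D-j+n-1}{n-1}}\right),$$ and the expected $h$-vector $\mathbb{E}[\underline{h}_A]=(1,\mathbb{E}[h_1],\mathbb{E}[h_2],\ldots)$ of $A$ is log-concave, and so in particular unimodal.
   Context: $\mathbb{k}$ is an infinite field and $S=\mathbb{k}[x_1,\ldots,x_n]$ is the polynomial ring in $n$ variables with the standard grading $\deg x_i=1$; $D$ is a fixed positive integer. For a monomial $x^b=x_1^{b_1}\cdots x_n^{b_n}$, $\mathrm{Ann}(x^b)=\langle x_1^{b_1+1},\ldots,x_n^{b_n+1}\rangle$, and for a set $B$ of monomials $\mathrm{Ann}(B)=\bigcap_{x^b\in B}\mathrm{Ann}(x^b)$ (the annihilator in the sense of Macaulay--Matlis duality). The algebra $A=S/\mathrm{Ann}(\mathcal{B})$ is an Artinian monomial level algebra whose socle is generated by the set $\mathcal{B}$ of monomials of degree $D$. $[A]_j$ denotes the degree-$j$ graded component of $A$. The expectation of the $h$-vector is taken entry-wise over the random set $\mathcal{B}$; the entry in degree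 $0$ of the expected $h$-vector is written as $1$. A sequence $(c_0,c_1,c_2,\ldots)$ of nonnegative real numbers is log-concave if $c_j^2\ge c_{j-1}c_{j+1}$ for all $j\ge 1$ (for a finite sequence, whenever all three terms are defined); it is unimodal if it does not strictly increase after a strict decrease.
   Formalization: The degree-0 entry of the expected h-vector is taken to be E[h_0] = 1 − q^{C(D+n−1,n−1)} instead of 1; with the entry 1 log-concavity fails, e.g. for n = 1, D = 3, p = 1/2. *)

theory Defs
  imports
    "HOL-Library.Poly_Mapping"
    "HOL-Algebra.QuotRing"
    "HOL-Probability.Product_PMF"
    "Jordan_Normal_Form.VS_Connect"
begin

text \<open>
  The polynomial ring \<open>S = k[x\<^sub>1,\<dots>,x\<^sub>n]\<close> is the monoid algebra of the exponent vectors, the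
  variables being indexed by a finite type \<open>'n\<close>, so that \<open>n = CARD('n)\<close>.
  As a structure with carrier it is \<^term>\<open>class_ring\<close> on this type.
\<close>

type_synonym ('n, 'k) mpoly = "('n \<Rightarrow>\<^sub>0 nat) \<Rightarrow>\<^sub>0 'k"

definition expdeg :: "('n::finite \<Rightarrow>\<^sub>0 nat) \<Rightarrow> nat"
  where "expdeg b = (\<Sum>i\<in>UNIV. Poly_Mapping.lookup b i)"

definition monomial :: "('n \<Rightarrow>\<^sub>0 nat) \<Rightarrow> ('n, 'k::comm_ring_1) mpoly"
  where "monomial b = Poly_Mapping.single b 1"

definition var :: "'n \<Rightarrow> ('n, 'k::comm_ring_1) mpoly"
  where "var i = monomial (Poly_Mapping.single i 1)"

definition const :: "'k \<Rightarrow> ('n, 'k::comm_ring_1) mpoly"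
  where "const c = Poly_Mapping.single 0 c"

definition homogeneous :: "nat \<Rightarrow> ('n::finite, 'k::comm_ring_1) mpoly set"
  where "homogeneous j = {f. \<forall>b \<in> Poly_Mapping.keys f. expdeg b = j}"

definition Mon :: "nat \<Rightarrow> ('n::finite, 'k::comm_ring_1) mpoly set"
  where "Mon D = {monomial b | b. expdeg b = D}"

definition Ann_monomial :: "('n::finite \<Rightarrow>\<^sub>0 nat) \<Rightarrow> ('n, 'k::comm_ring_1) mpoly set"
  where "Ann_monomial b =
    Idl\<^bsub>class_ring\<^esub> {var i ^ (Poly_Mapping.lookup b i + 1) | i. i \<in> UNIV}"

text \<open>The empty intersection is the whole ring: \<open>Ann {} = S\<close>, so the algebra below is then zero.\<close>

definition Ann :: "('n::finite, 'k::comm_ring_1) mpoly set \<Rightarrow> ('n, 'k) mpoly set"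
  where "Ann B = \<Inter> {Ann_monomial b | b. monomial b \<in> B}"

text \<open>
  The quotient ring \<open>S / Ann B\<close> as an algebra over the coefficient field, which acts through
  the residue classes of the constant polynomials.
\<close>

definition level_algebra ::
    "('n::finite, 'k::comm_ring_1) mpoly set \<Rightarrow> ('k, ('n, 'k) mpoly set) module"
  where "level_algebra B =
    (let A = class_ring Quot Ann B in
     \<lparr>carrier = carrier A, monoid.mult = monoid.mult A, one = one A, zero = zero A, add = add A,
      smult = (\<lambda>c X. (Ann B +>\<^bsub>class_ring\<^esub> const c) \<otimes>\<^bsub>A\<^esub> X)\<rparr>)"

text \<open>
  \<open>Ann B\<close> is a homogeneous ideal, so the degree \<open>j\<close> component of the quotient is the image of
  the degree \<open>j\<close> component of \<open>S\<close>.
\<close>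

definition graded_component ::
    "('n::finite, 'k::comm_ring_1) mpoly set \<Rightarrow> nat \<Rightarrow> ('k, ('n, 'k) mpoly set) module"
  where "graded_component B j =
    (level_algebra B)\<lparr>carrier := (\<lambda>f. Ann B +>\<^bsub>class_ring\<^esub> f) ` homogeneous j\<rparr>"

definition hilbert_function :: "('n::finite, 'k::field) mpoly set \<Rightarrow> nat \<Rightarrow> nat"
  where "hilbert_function B j = vectorspace.dim class_ring (graded_component B j)"

text \<open>Each element of the finite set \<open>M\<close> is included independently with probability \<open>p\<close>.\<close>

definition random_subset :: "'a set \<Rightarrow> real \<Rightarrow> 'a set pmf"
  where "random_subset M p =
    map_pmf (\<lambda>f. {m \<in> M. f m}) (Pi_pmf M False (\<lambda>_. bernoulli_pmf p))"

text \<open>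
  The expectation is entry-wise and unconditional in every degree.  In degree \<open>0\<close> this is the
  probability that the random set is nonempty, i.e. that the algebra is nonzero: the value
  \<open>1 - (1 - p) ^ N\<close> with \<open>N\<close> the number of monomials of degree \<open>D\<close>, and not the number \<open>1\<close>.
\<close>

definition expected_h_vector ::
    "'k::field itself \<Rightarrow> 'n::finite itself \<Rightarrow> nat \<Rightarrow> real \<Rightarrow> nat \<Rightarrow> real"
  where "expected_h_vector _ _ D p j =
    measure_pmf.expectation (random_subset (Mon D :: ('n, 'k) mpoly set) p)
      (\<lambda>B. real (hilbert_function B j))"

definition log_concave_seq :: "(nat \<Rightarrow> real) \<Rightarrow> bool"
  where "log_concave_seq c \<longleftrightarrow> (\<forall>j\<ge>1. c j ^ 2 \<ge> c (j - 1) * c (j + 1))"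

definition unimodal_seq :: "(nat \<Rightarrow> real) \<Rightarrow> bool"
  where "unimodal_seq c \<longleftrightarrow> (\<forall>i j. i < j \<and> c (i + 1) < c i \<longrightarrow> c (j + 1) \<le> c j)"

end

theory Submission
  imports Defs
begin

text \<open>
  Everything takes place on exponent vectors. The ideal \<open>Ann (x\<^sup>b)\<close> is spanned by the monomials that
  do not divide \<open>x\<^sup>b\<close> (\<open>Ann_monomial_eq\<close>), hence \<open>Ann B\<close> is spanned by the monomials that divide no
  member of \<open>B\<close>, and the residue classes of the remaining monomials of degree \<open>j\<close> form a basis of
  the degree \<open>j\<close> component (\<open>hilbert_function_eq_card\<close>). So \<open>h\<^sub>j\<close> counts the monomials of degree
  \<open>j\<close> having a multiple in the random set. Write \<open>N d\<close> for the number \<open>(d + n - 1) choose (n - 1)\<close>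
  of monomials of degree \<open>d\<close>. A monomial of degree \<open>j \<le> D\<close> has \<open>N (D - j)\<close> multiples of degree
  \<open>D\<close>, all of which are missed with probability \<open>q ^ N (D - j)\<close>. Linearity of expectation then gives
  \<open>E[h\<^sub>j] = N j * (1 - q ^ N (D - j))\<close> for \<open>j \<le> D\<close>, and \<open>0\<close> for \<open>j > D\<close>
  (\<open>expectation_hilbert_function\<close>).
  
  For log-concavity it suffices to treat the two factors separately. The sequence \<open>N\<close> is
  log-concave because the ratio \<open>N (j + 1) / N j = (j + n) / (j + 1)\<close> decreases. The second factor
  is the function \<open>x \<mapsto> 1 - q ^ x\<close> evaluated along the reversed sequence \<open>N\<close>. This function
  carries positive increasing log-concave sequences to log-concave sequences: that \<open>ln (1 - q ^ x)\<close> is a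
  concave function of \<open>ln x\<close> comes down to the convexity of a power function
  (\<open>one_minus_power_log_concave\<close>). Unimodality follows since the expected \<open>h\<close>-vector is positive up
  to degree \<open>D\<close> and zero afterwards, so that no internal zero separates two positive entries.
\<close>

section \<open>Exponent vectors\<close>

text \<open>
  Divisibility of monomials. It has to be spelled out pointwise, since the order that finitely
  supported functions carry is a linear one and not the componentwise order.
\<close>

definition divides_exp :: "('n \<Rightarrow>\<^sub>0 nat) \<Rightarrow> ('n \<Rightarrow>\<^sub>0 nat) \<Rightarrow> bool"
  where "divides_exp k b \<longleftrightarrow> (\<forall>i. Poly_Mapping.lookup k i \<le> Poly_Mapping.lookup b i)"

lemma expdeg_add: "expdeg (k + c) = expdeg k + expdeg c"
  by (simp add: expdeg_def lookup_add sum.distrib)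

lemma divides_exp_iff_add: "divides_exp k b \<longleftrightarrow> (\<exists>c. b = k + c)"
proof
  assume "divides_exp k b"
  hence "b = k + (b - k)"
    by (intro poly_mapping_eqI) (simp add: lookup_add lookup_minus divides_exp_def)
  thus "\<exists>c. b = k + c" ..
qed (auto simp: divides_exp_def lookup_add)

text \<open>
  Listing the variables turns exponent vectors of degree \<open>j\<close> into lists of length \<open>CARD('n)\<close> with
  sum \<open>j\<close>, which stars and bars counts.
\<close>

lemma card_exponents_of_degree:
  "card {b :: 'n::finite \<Rightarrow>\<^sub>0 nat. expdeg b = j} = (j + CARD('n) - 1) choose (CARD('n) - 1)"
  and finite_exponents_of_degree: "finite {b :: 'n::finite \<Rightarrow>\<^sub>0 nat. expdeg b = j}"
proof -
  obtain xs :: "'n list" where xs: "set xs = UNIV" "distinct xs"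
    using finite_distinct_list[OF finite_class.finite_UNIV] by auto
  have len: "length xs = CARD('n)" using xs distinct_card by metis
  define enc where "enc = (\<lambda>b :: 'n \<Rightarrow>\<^sub>0 nat. map (Poly_Mapping.lookup b) xs)"
  have sum_enc: "sum_list (enc b) = expdeg b" for b
    using xs by (simp add: enc_def expdeg_def sum_list_distinct_conv_sum_set)
  have inj: "inj enc"
    using xs by (auto simp: enc_def inj_on_def intro!: poly_mapping_eqI)
  have surj: "\<exists>b. enc b = l" if "length l = CARD('n)" for l
  proof
    have "map (\<lambda>x. the (map_of (zip xs l) x)) xs = l"
      using xs that len by (intro nth_equalityI) (auto simp: map_of_zip_nth)
    moreover have "Poly_Mapping.lookup (Abs_poly_mapping f) = f" for f :: "'n \<Rightarrow> nat"
      by simp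
    ultimately show "enc (Abs_poly_mapping (\<lambda>x. the (map_of (zip xs l) x))) = l"
      by (simp add: enc_def)
  qed
  have im: "enc ` {b. expdeg b = j} = {l. length l = CARD('n) \<and> sum_list l = j}"
  proof (intro equalityI subsetI)
    fix l assume "l \<in> {l. length l = CARD('n) \<and> sum_list l = j}"
    with surj[of l] show "l \<in> enc ` {b. expdeg b = j}"
      by (auto simp: sum_enc)
  qed (auto simp: sum_enc, simp add: enc_def len)
  have pos: "CARD('n) > 0" by simp
  have "card {b :: 'n \<Rightarrow>\<^sub>0 nat. expdeg b = j} = card (enc ` {b. expdeg b = j})"
    using inj by (metis card_image inj_on_subset subset_UNIV)
  also have "\<dots> = (j + CARD('n) - 1) choose j"
    by (simp only: im card_length_sum_list)
  also have "\<dots> = (j + CARD('n) - 1) choose (CARD('n) - 1)"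
    using pos by (subst binomial_symmetric) auto
  finally show "card {b :: 'n::finite \<Rightarrow>\<^sub>0 nat. expdeg b = j}
    = (j + CARD('n) - 1) choose (CARD('n) - 1)" .
  thus "finite {b :: 'n::finite \<Rightarrow>\<^sub>0 nat. expdeg b = j}"
    \<comment> \<open>An infinite set would have cardinality zero, but the binomial coefficient is positive.\<close>
    using pos by (intro card_ge_0_finite) simp
qed

text \<open>
  A multiple of \<open>x\<^sup>k\<close> is determined by its cofactor, which is an arbitrary monomial of degree
  \<open>D - expdeg k\<close>.
\<close>

lemma card_multiples_of_degree:
  fixes k :: "'n::finite \<Rightarrow>\<^sub>0 nat"
  assumes "expdeg k \<le> D"
  shows "card {b. expdeg b = D \<and> divides_exp k b}
    = (D - expdeg k + CARD('n) - 1) choose (CARD('n) - 1)"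
proof -
  have "{b. expdeg b = D \<and> divides_exp k b} = (+) k ` {c. expdeg c = D - expdeg k}"
    using assms by (auto simp: divides_exp_iff_add expdeg_add)
  moreover have "inj_on ((+) k) X" for X
    by (auto intro: inj_onI)
  ultimately show ?thesis
    by (simp add: card_image card_exponents_of_degree)
qed

section \<open>Monomial ideals and annihilators\<close>

text \<open>
  All ideals below have this form: their members are recognised term by term. Closure under
  multiplication is exactly the assumption that \<open>U\<close> absorbs addition.
\<close>

lemma monomial_ideal:
  fixes U :: "('n \<Rightarrow>\<^sub>0 nat) set"
  assumes up: "\<And>k c. k \<in> U \<Longrightarrow> k + c \<in> U"
  shows "ideal {f :: ('n, 'k::comm_ring_1) mpoly. Poly_Mapping.keys f \<subseteq> U} class_ring"
proof (rule idealI)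
  show "subgroup {f :: ('n, 'k) mpoly. Poly_Mapping.keys f \<subseteq> U} (add_monoid class_ring)"
  proof (rule group.subgroupI)
    show "Group.group (add_monoid (class_ring :: ('n, 'k) mpoly ring))"
      by (intro comm_group.axioms(2) abelian_group.a_comm_group ring.is_abelian_group
          class_ring.ring_axioms)
    fix f g :: "('n, 'k) mpoly"
    assume f: "f \<in> {f. Poly_Mapping.keys f \<subseteq> U}"
    have inv: "inv\<^bsub>add_monoid class_ring\<^esub> f = - f"
      using class_ring_simps unfolding a_inv_def[symmetric] by metis
    show "inv\<^bsub>add_monoid class_ring\<^esub> f \<in> {f. Poly_Mapping.keys f \<subseteq> U}"
      using f unfolding inv by simp
    assume "g \<in> {f. Poly_Mapping.keys f \<subseteq> U}"
    with f show "f \<otimes>\<^bsub>add_monoid class_ring\<^esub> g \<in> {f. Poly_Mapping.keys f \<subseteq> U}"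
      using Poly_Mapping.keys_add[of f g] by auto
  qed (auto intro: exI[of _ 0])
next
  fix f g :: "('n, 'k) mpoly"
  assume "f \<in> {f. Poly_Mapping.keys f \<subseteq> U}"
  hence *: "Poly_Mapping.keys (f * g) \<subseteq> U"
    using keys_mult[of f g] up by blast
  thus "f \<otimes>\<^bsub>class_ring\<^esub> g \<in> {f. Poly_Mapping.keys f \<subseteq> U}" by simp
  from * show "g \<otimes>\<^bsub>class_ring\<^esub> f \<in> {f. Poly_Mapping.keys f \<subseteq> U}" by (simp add: mult.commute)
qed (rule class_ring.ring_axioms)

lemma var_power:
  "(var i :: ('n, 'k::comm_ring_1) mpoly) ^ m
    = Poly_Mapping.single (Poly_Mapping.single i m) 1"
  by (induction m) (simp_all add: var_def monomial_def mult_single flip: single_add)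

lemma lookup_sum_of_terms:
  assumes "finite T"
  shows "Poly_Mapping.lookup (\<Sum>k\<in>T. Poly_Mapping.single k (c k)) m = (if m \<in> T then c m else 0)"
  using assms by (simp add: lookup_sum lookup_single when_def)

text \<open>
  A monomial \<open>x\<^sup>k\<close> fails to divide \<open>x\<^sup>b\<close> exactly when some \<open>k\<^sub>i \<ge> b\<^sub>i + 1\<close>, that is, when it is a
  multiple of one of the generators. The polynomials with only such terms form an ideal, so they
  make up the generated ideal.
\<close>

lemma Ann_monomial_eq:
  "Ann_monomial b = {f :: ('n::finite, 'k::comm_ring_1) mpoly.
     Poly_Mapping.keys f \<subseteq> {k. \<not> divides_exp k b}}"
    (is "_ = ?I")
proof
  let ?G = "{var i ^ (Poly_Mapping.lookup b i + 1) | i. i \<in> UNIV} :: ('n, 'k) mpoly set"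
  have "ideal ?I class_ring"
    by (rule monomial_ideal) (auto simp: divides_exp_def lookup_add dest: le_trans[OF le_add1] add_leD1)
  moreover have "?G \<subseteq> ?I"
  proof
    fix f assume "f \<in> ?G"
    then obtain i where "f = Poly_Mapping.single (Poly_Mapping.single i (Poly_Mapping.lookup b i + 1)) 1"
      unfolding var_power by blast
    moreover have "\<not> divides_exp (Poly_Mapping.single i (Poly_Mapping.lookup b i + 1)) b"
      unfolding divides_exp_def by (rule notI, drule spec[of _ i]) simp
    ultimately show "f \<in> ?I" by simp
  qed
  ultimately show "Ann_monomial b \<subseteq> ?I"
    unfolding Ann_monomial_def by (rule ring.genideal_minimal[OF class_ring.ring_axioms])
  interpret J: ideal "Ann_monomial b" "class_ring :: ('n, 'k) mpoly ring"
    unfolding Ann_monomial_def by (rule ring.genideal_ideal[OF class_ring.ring_axioms]) simp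
  have gen: "var i ^ (Poly_Mapping.lookup b i + 1) \<in> (Ann_monomial b :: ('n, 'k) mpoly set)" for i
    using ring.genideal_self[OF class_ring.ring_axioms, of ?G] unfolding Ann_monomial_def by auto
  show "?I \<subseteq> Ann_monomial b"
  proof
    fix f :: "('n, 'k) mpoly" assume f: "f \<in> ?I"
    have "f = (\<Sum>k\<in>Poly_Mapping.keys f. Poly_Mapping.single k (Poly_Mapping.lookup f k))"
      by (rule poly_mapping_eqI) (simp add: lookup_sum_of_terms in_keys_iff)
    moreover have "(\<Sum>k\<in>T. Poly_Mapping.single k (Poly_Mapping.lookup f k)) \<in> Ann_monomial b"
      if "finite T" "T \<subseteq> Poly_Mapping.keys f" for T
      using that
    proof (induction T rule: finite_induct)
      case empty
      show ?case using J.zero_closed by simp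
    next
      case (insert k T)
      then obtain i where i: "Poly_Mapping.lookup b i < Poly_Mapping.lookup k i"
        using f by (auto simp: divides_exp_def not_le)
      \<comment> \<open>Split the generator \<open>x\<^sub>i ^ (b\<^sub>i + 1)\<close> off the term.\<close>
      let ?v = "Poly_Mapping.single i (Poly_Mapping.lookup b i + 1)"
      have k: "k = (k - ?v) + ?v"
        using i by (intro poly_mapping_eqI) (auto simp: lookup_add lookup_minus lookup_single when_def)
      have "Poly_Mapping.single k (Poly_Mapping.lookup f k)
        = Poly_Mapping.single (k - ?v) (Poly_Mapping.lookup f k) * var i ^ (Poly_Mapping.lookup b i + 1)"
        unfolding var_power mult_single by (subst k) simp
      hence "Poly_Mapping.single k (Poly_Mapping.lookup f k) \<in> Ann_monomial b"
        using J.I_l_closed[OF gen[of i]] by simp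
      then show ?case
        using insert J.a_closed by simp
    qed
    ultimately show "f \<in> Ann_monomial b"
      by (metis finite_keys order_refl)
  qed
qed

lemma Ann_eq:
  "Ann B = {f :: ('n::finite, 'k::comm_ring_1) mpoly.
     Poly_Mapping.keys f \<subseteq> {k. \<forall>b. monomial b \<in> B \<longrightarrow> \<not> divides_exp k b}}"
  unfolding Ann_def Ann_monomial_eq by auto

lemma ideal_Ann: "ideal (Ann B :: ('n::finite, 'k::comm_ring_1) mpoly set) class_ring"
  unfolding Ann_eq
  by (rule monomial_ideal) (auto simp: divides_exp_def lookup_add dest: add_leD1)


section \<open>The Hilbert function of a monomial level algebra\<close>

lemma coset_eq: "H +>\<^bsub>class_ring\<^esub> (f :: ('n, 'k::comm_ring_1) mpoly) = {h. h - f \<in> H}"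
  by (force simp: a_r_coset_def')

abbreviation residue :: "('n::finite, 'k::comm_ring_1) mpoly set \<Rightarrow> ('n, 'k) mpoly \<Rightarrow> ('n, 'k) mpoly set"
  where "residue B f \<equiv> Ann B +>\<^bsub>class_ring\<^esub> f"

lemma residue_eq_iff: "residue B f = residue B g \<longleftrightarrow> f - g \<in> Ann B"
proof -
  have diff: "h - h' \<in> Ann B" if "h \<in> Ann B" "h' \<in> Ann B" for h h' :: "('a, 'b) mpoly"
    using that Poly_Mapping.keys_diff[of h h'] unfolding Ann_eq by blast
  show ?thesis
  proof
    assume "residue B f = residue B g"
    moreover have "f \<in> residue B f" by (simp add: coset_eq Ann_eq)
    ultimately show "f - g \<in> Ann B" by (simp add: coset_eq)
  next
    assume fg: "f - g \<in> Ann B"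
    have "h - f \<in> Ann B \<longleftrightarrow> h - g \<in> Ann B" for h
    proof
      assume "h - f \<in> Ann B"
      \<comment> \<open>Written with differences only: \<open>h - g = (h - f) - (0 - (f - g))\<close>, where \<open>0 = (f - g) - (f - g)\<close>.\<close>
      from diff[OF this diff[OF diff[OF fg fg] fg]] show "h - g \<in> Ann B" by simp
    next
      assume "h - g \<in> Ann B"
      from diff[OF this fg] show "h - f \<in> Ann B" by simp
    qed
    thus "residue B f = residue B g" by (simp add: coset_eq)
  qed
qed

text \<open>
  These rules replace the coset operations by operations on representatives; with them the
  vector space axioms reduce to ring identities of polynomials.
\<close>

lemma graded_component_simps:
  "carrier (graded_component B j) = residue B ` homogeneous j"
  "zero (graded_component B j) = residue B 0"
  "residue B f \<oplus>\<^bsub>graded_component B j\<^esub> residue B g = residue B (f + g)"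
  "c \<odot>\<^bsub>graded_component B j\<^esub> residue B f = residue B (const c * f)"
proof -
  interpret I: ideal "Ann B" class_ring by (rule ideal_Ann)
  show "carrier (graded_component B j) = residue B ` homogeneous j"
    by (simp add: graded_component_def)
  show "zero (graded_component B j) = residue B 0"
    by (simp add: graded_component_def level_algebra_def Let_def FactRing_def coset_eq)
  show "residue B f \<oplus>\<^bsub>graded_component B j\<^esub> residue B g = residue B (f + g)"
    using I.a_rcos_sum[of f g]
    by (simp add: graded_component_def level_algebra_def Let_def FactRing_def)
  show "c \<odot>\<^bsub>graded_component B j\<^esub> residue B f = residue B (const c * f)"
    using I.rcoset_mult_add[of "const c" f]
    by (simp add: graded_component_def level_algebra_def Let_def FactRing_def)
qed

lemma homogeneous_closed:
  "0 \<in> homogeneous j"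
  "f \<in> homogeneous j \<Longrightarrow> g \<in> homogeneous j \<Longrightarrow> f + g \<in> homogeneous j"
  "f \<in> homogeneous j \<Longrightarrow> - f \<in> homogeneous j"
  "f \<in> homogeneous j \<Longrightarrow> const c * f \<in> homogeneous j"
  "f \<in> homogeneous j \<Longrightarrow> f * const c \<in> homogeneous j"
  using Poly_Mapping.keys_add[of f g] keys_mult[of "const c" f] keys_mult[of f "const c"]
  by (auto simp: homogeneous_def const_def split: if_splits)

lemma const_simps:
  "const (c * d) = const c * const d" "const (c + d) = const c + const d" "const 1 = 1"
  by (simp_all add: const_def mult_single single_add)

lemma vectorspace_graded_component:
  "vectorspace (class_ring :: 'k::field ring) (graded_component (B :: ('n::finite, 'k) mpoly set) j)"
proof (rule vs_criteria)
  let ?V = "graded_component B j"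
  show "\<forall>v\<in>carrier ?V. \<exists>w\<in>carrier ?V. v \<oplus>\<^bsub>?V\<^esub> w = \<zero>\<^bsub>?V\<^esub>"
  proof
    fix v assume "v \<in> carrier ?V"
    then obtain f where "f \<in> homogeneous j" "v = residue B f"
      by (auto simp: graded_component_simps)
    thus "\<exists>w\<in>carrier ?V. v \<oplus>\<^bsub>?V\<^esub> w = \<zero>\<^bsub>?V\<^esub>"
      by (intro bexI[of _ "residue B (- f)"]) (simp_all add: graded_component_simps homogeneous_closed)
  qed
qed (auto simp: graded_component_simps homogeneous_closed class_field const_simps algebra_simps)

text \<open>
  The dimension read off from an indexed basis, with coefficients attached to the indices.
  Monomials are natural indices for their residue classes, and this avoids linear combinations
  whose coefficients are functions of cosets.
\<close>

lemma (in vectorspace) dim_eq_card_family: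
  assumes fin: "finite T" and e: "e \<in> T \<rightarrow> carrier V" and inj: "inj_on e T"
    and gen: "\<And>v. v \<in> carrier V \<Longrightarrow> \<exists>c \<in> T \<rightarrow> carrier K. v = (\<Oplus>\<^bsub>V\<^esub>t\<in>T. c t \<odot>\<^bsub>V\<^esub> e t)"
    and indep: "\<And>c. c \<in> T \<rightarrow> carrier K \<Longrightarrow> (\<Oplus>\<^bsub>V\<^esub>t\<in>T. c t \<odot>\<^bsub>V\<^esub> e t) = \<zero>\<^bsub>V\<^esub>
      \<Longrightarrow> \<forall>t\<in>T. c t = \<zero>\<^bsub>K\<^esub>"
  shows "dim = card T"
proof -
  have lc: "lincomb a (e ` T) = (\<Oplus>\<^bsub>V\<^esub>t\<in>T. a (e t) \<odot>\<^bsub>V\<^esub> e t)" if "a \<in> e ` T \<rightarrow> carrier K" for a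
    unfolding lincomb_def using that e inj by (intro finsum_reindex) auto
  have "lin_indpt (e ` T)"
  proof (rule finite_lin_indpt2)
    fix a assume a: "a \<in> e ` T \<rightarrow> carrier K" "lincomb a (e ` T) = \<zero>\<^bsub>V\<^esub>"
    have "(\<lambda>t. a (e t)) \<in> T \<rightarrow> carrier K" using a(1) by blast
    moreover have "(\<Oplus>\<^bsub>V\<^esub>t\<in>T. a (e t) \<odot>\<^bsub>V\<^esub> e t) = \<zero>\<^bsub>V\<^esub>"
      using a(2) unfolding lc[OF a(1)] .
    ultimately have "\<forall>t\<in>T. a (e t) = \<zero>\<^bsub>K\<^esub>" by (rule indep)
    thus "\<forall>v\<in>e ` T. a v = \<zero>\<^bsub>K\<^esub>" by blast
  qed (use fin e in auto)
  moreover have "gen_set (e ` T)"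
  proof
    show "span (e ` T) \<subseteq> carrier V" using e by (intro span_is_subset2) auto
    show "carrier V \<subseteq> span (e ` T)"
    proof
      fix v assume "v \<in> carrier V"
      then obtain c where c: "c \<in> T \<rightarrow> carrier K" "v = (\<Oplus>\<^bsub>V\<^esub>t\<in>T. c t \<odot>\<^bsub>V\<^esub> e t)"
        using gen by blast
      define a where "a = (\<lambda>v. c (inv_into T e v))"
      have a: "a \<in> e ` T \<rightarrow> carrier K" using c inj by (auto simp: a_def)
      have "v = lincomb a (e ` T)"
        unfolding lc[OF a] c(2) using c(1) e inj
        by (intro finsum_cong') (auto simp: a_def intro!: smult_closed)
      with a fin show "v \<in> span (e ` T)" unfolding span_def by blast
    qed
  qed
  ultimately have "basis (e ` T)" using e by (auto simp: basis_def)
  thus ?thesis using dim_basis[of "e ` T"] fin inj by (simp add: card_image)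
qed

text \<open>
  The monomials of degree \<open>j\<close> outside \<open>Ann B\<close> give a basis: a homogeneous polynomial may be
  stripped of its terms in \<open>Ann B\<close> without changing its residue class, and a combination of the
  remaining monomials that lies in \<open>Ann B\<close> has no terms at all, because \<open>Ann B\<close> contains every
  term of each of its members.
\<close>

lemma hilbert_function_eq_card:
  fixes B :: "('n::finite, 'k::field) mpoly set"
  shows "hilbert_function B j = card {k. expdeg k = j \<and> (\<exists>b. monomial b \<in> B \<and> divides_exp k b)}"
proof -
  let ?V = "graded_component B j"
  define T where "T = {k. expdeg k = j \<and> (\<exists>b. monomial b \<in> B \<and> divides_exp k b)}"
  define e where "e = (\<lambda>k. residue B (monomial k))"
  interpret V: vectorspace "class_ring :: 'k ring" ?V
    by (rule vectorspace_graded_component)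
  have finT: "finite T" using finite_exponents_of_degree[of j] unfolding T_def by (rule finite_subset[rotated]) auto
  have hom: "Poly_Mapping.single k c \<in> homogeneous j" if "k \<in> T" for k and c :: 'k
    using that by (auto simp: homogeneous_def T_def split: if_splits)
  have e: "e \<in> T \<rightarrow> carrier ?V"
    using hom by (auto simp: e_def graded_component_simps monomial_def)
  have comb: "(\<Oplus>\<^bsub>?V\<^esub>k\<in>X. c k \<odot>\<^bsub>?V\<^esub> e k) = residue B (\<Sum>k\<in>X. Poly_Mapping.single k (c k))"
    if "X \<subseteq> T" for X c
    using finite_subset[OF that finT] that
  proof (induction X rule: finite_induct)
    case (insert k X)
    have "(\<lambda>k. c k \<odot>\<^bsub>?V\<^esub> e k) \<in> X \<rightarrow> carrier ?V" "c k \<odot>\<^bsub>?V\<^esub> e k \<in> carrier ?V"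
      using e insert.prems by (auto intro!: V.smult_closed)
    then show ?case
      using insert by (simp add: graded_component_simps e_def monomial_def const_def mult_single)
  qed (simp add: graded_component_simps)
  have not_Ann: "f \<notin> Ann B" if "k \<in> T" "k \<in> Poly_Mapping.keys f" for f k
    using that by (auto simp: Ann_eq T_def)
  have "V.dim = card T"
  proof (rule V.dim_eq_card_family[OF finT e])
    show "inj_on e T"
    proof (rule inj_onI, rule ccontr)
      fix k l assume kl: "k \<in> T" "l \<in> T" "e k = e l" "k \<noteq> l"
      have "k \<in> Poly_Mapping.keys (monomial k - monomial l :: ('n, 'k) mpoly)"
        using kl(4) by (simp add: in_keys_iff monomial_def lookup_minus lookup_single when_def)
      with not_Ann kl(1,3) show False by (auto simp: e_def residue_eq_iff)
    qed
  next
    fix v assume "v \<in> carrier ?V"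
    then obtain f where f: "f \<in> homogeneous j" "v = residue B f"
      by (auto simp: graded_component_simps)
    \<comment> \<open>The part of \<open>f\<close> that survives modulo \<open>Ann B\<close>.\<close>
    let ?g = "\<Sum>k\<in>T. Poly_Mapping.single k (Poly_Mapping.lookup f k)"
    have "Poly_Mapping.keys (f - ?g) \<subseteq> Poly_Mapping.keys f - T"
      using finT by (auto simp: in_keys_iff lookup_minus lookup_sum_of_terms split: if_splits)
    moreover have "Poly_Mapping.keys f - T \<subseteq> {k. \<forall>b. monomial b \<in> B \<longrightarrow> \<not> divides_exp k b}"
      using f(1) unfolding T_def homogeneous_def by blast
    ultimately have "f - ?g \<in> Ann B" unfolding Ann_eq by blast
    hence "v = residue B ?g"
      by (simp add: f(2) residue_eq_iff)
    thus "\<exists>c\<in>T \<rightarrow> carrier class_ring. v = (\<Oplus>\<^bsub>?V\<^esub>t\<in>T. c t \<odot>\<^bsub>?V\<^esub> e t)"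
      by (intro bexI[of _ "Poly_Mapping.lookup f"]) (simp_all add: comb)
  next
    fix c assume "(\<Oplus>\<^bsub>?V\<^esub>t\<in>T. c t \<odot>\<^bsub>?V\<^esub> e t) = \<zero>\<^bsub>?V\<^esub>"
    hence "(\<Sum>k\<in>T. Poly_Mapping.single k (c k)) \<in> Ann B"
      by (simp add: comb graded_component_simps residue_eq_iff)
    thus "\<forall>t\<in>T. c t = \<zero>\<^bsub>class_ring\<^esub>"
      using not_Ann finT by (metis in_keys_iff ring.simps(1) lookup_sum_of_terms)
  qed
  thus ?thesis by (simp add: hilbert_function_def T_def)
qed

lemma expdeg_mono: "divides_exp k b \<Longrightarrow> expdeg k \<le> expdeg b"
  by (auto simp: divides_exp_def expdeg_def intro: sum_mono)

section \<open>Random subsets and expected cardinalities\<close>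

lemma inj_monomial: "inj (monomial :: _ \<Rightarrow> ('n, 'k::comm_ring_1) mpoly)"
proof (rule injI)
  fix a b :: "'n \<Rightarrow>\<^sub>0 nat"
  assume "monomial a = (monomial b :: ('n, 'k) mpoly)"
  hence "Poly_Mapping.keys (monomial a :: ('n, 'k) mpoly) = Poly_Mapping.keys (monomial b :: ('n, 'k) mpoly)"
    by simp
  thus "a = b" by (simp add: monomial_def)
qed

text \<open>
  The event is a box in the product space of the independent choices, each element of \<open>N\<close> being
  forced out and every other element being free.
\<close>

lemma prob_random_subset_avoids:
  assumes "finite M" "N \<subseteq> M" "0 \<le> p" "p \<le> 1"
  shows "measure_pmf.prob (random_subset M p) {B. B \<inter> N = {}} = (1 - p) ^ card N"
proof -
  have "(\<lambda>f. {m \<in> M. f m}) -` {B. B \<inter> N = {}} = Pi M (\<lambda>m. if m \<in> N then {False} else UNIV)"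
    using assms(2) by (auto simp: Pi_def split: if_splits)
  hence "measure_pmf.prob (random_subset M p) {B. B \<inter> N = {}}
    = (\<Prod>m\<in>M. measure_pmf.prob (bernoulli_pmf p) (if m \<in> N then {False} else UNIV))"
    using assms(1) by (simp add: random_subset_def measure_Pi_pmf_Pi)
  also have "\<dots> = (\<Prod>m\<in>M. if m \<in> N then 1 - p else 1)"
    using assms(3,4) by (intro prod.cong) (auto simp: measure_pmf_single)
  also have "\<dots> = (\<Prod>m\<in>N. 1 - p)"
    using assms(1,2) by (simp add: prod.If_cases Int_absorb1)
  finally show ?thesis by simp
qed

text \<open>
  Linearity of expectation: the sets \<open>N x\<close> may overlap, so the events that they are hit are in
  general dependent, but only their individual probabilities enter.
\<close>

lemma expectation_card_hit:
  assumes "finite M" "0 \<le> p" "p \<le> 1" "finite X" "\<And>x. x \<in> X \<Longrightarrow> N x \<subseteq> M"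
  shows "measure_pmf.expectation (random_subset M p) (\<lambda>B. real (card {x \<in> X. B \<inter> N x \<noteq> {}}))
    = (\<Sum>x\<in>X. 1 - (1 - p) ^ card (N x))"
proof -
  let ?R = "random_subset M p"
  have "real (card {x \<in> X. B \<inter> N x \<noteq> {}}) = (\<Sum>x\<in>X. indicator (- {B. B \<inter> N x = {}}) B)" for B
    using assms(4) by (simp add: indicator_def sum.If_cases Int_def)
  hence "measure_pmf.expectation ?R (\<lambda>B. real (card {x \<in> X. B \<inter> N x \<noteq> {}}))
    = measure_pmf.expectation ?R (\<lambda>B. \<Sum>x\<in>X. indicator (- {B. B \<inter> N x = {}}) B)"
    by presburger
  also have "\<dots> = (\<Sum>x\<in>X. measure_pmf.prob ?R (- {B. B \<inter> N x = {}}))"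
    by (subst Bochner_Integration.integral_sum) (auto simp: less_top[symmetric])
  also have "\<dots> = (\<Sum>x\<in>X. 1 - (1 - p) ^ card (N x))"
    using assms measure_pmf.prob_compl[of _ ?R]
    by (intro sum.cong) (auto simp: Compl_eq_Diff_UNIV prob_random_subset_avoids)
  finally show ?thesis .
qed

section \<open>Log-concave sequences\<close>

lemma binomial_shift_Suc:
  assumes "n \<ge> 1"
  shows "(Suc j) * ((Suc j + n - 1) choose (n - 1)) = (j + n) * ((j + n - 1) choose (n - 1))"
proof -
  obtain m where n: "n = Suc m" using assms by (cases n) auto
  have "Suc j * (Suc (j + m) choose Suc j) = Suc (j + m) * ((j + m) choose j)"
    using Suc_times_binomial_eq[of "j + m" j] by (simp only: mult.commute)
  moreover have "Suc (j + m) choose Suc j = Suc (j + m) choose m"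
    using binomial_symmetric[of "Suc j" "Suc (j + m)"] by simp
  moreover have "(j + m) choose j = (j + m) choose m"
    using binomial_symmetric[of j "j + m"] by simp
  ultimately show ?thesis by (simp add: n)
qed

lemma binomial_shift_log_concave:
  assumes "n \<ge> 1"
  shows "real ((j + n - 1) choose (n - 1)) * real ((Suc (Suc j) + n - 1) choose (n - 1))
    \<le> real ((Suc j + n - 1) choose (n - 1)) ^ 2"
proof -
  define a where "a = (\<lambda>j. real ((j + n - 1) choose (n - 1)))"
  have rec: "real (Suc i) * a (Suc i) = real (i + n) * a i" for i
    unfolding a_def using binomial_shift_Suc[OF assms, of i]
    by (metis of_nat_mult)
  have pos: "a i \<ge> 0" for i by (simp add: a_def)
  have "(real (j + n) * a j) * (real (Suc (Suc j)) * a (Suc (Suc j)))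
      = real (Suc j) * real (Suc j + n) * a (Suc j) ^ 2"
    unfolding rec[of j, symmetric] rec[of "Suc j"] by (simp only: power2_eq_square mult_ac)
  also have "\<dots> \<le> (real (j + n) * real (Suc (Suc j))) * a (Suc j) ^ 2"
    using assms by (intro mult_right_mono) (auto simp: algebra_simps)
  finally have "(real (j + n) * real (Suc (Suc j))) * (a j * a (Suc (Suc j)))
      \<le> (real (j + n) * real (Suc (Suc j))) * a (Suc j) ^ 2"
    by (simp only: mult_ac)
  moreover have "real (j + n) * real (Suc (Suc j)) > 0" using assms by auto
  ultimately have "a j * a (Suc (Suc j)) \<le> a (Suc j) ^ 2"
    using mult_le_cancel_left_pos by blast
  thus ?thesis by (simp add: a_def)
qed

text \<open>
  With \<open>l = y / x\<close>, \<open>s = q ^ x\<close> and \<open>t = q ^ y = s powr l\<close> the claim follows from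
  \<open>(1 - q ^ y) / (1 - q ^ x) = (1 - s powr l) / (1 - s) \<ge> (1 - t powr l) / (1 - t)\<close>, where
  \<open>t powr l = q powr (y\<^sup>2 / x) \<le> q ^ z\<close>. The middle inequality compares the slopes at \<open>1\<close> of two
  chords of the function \<open>u powr l\<close>, which is convex because \<open>l \<ge> 1\<close>, and \<open>t \<le> s\<close>.
\<close>

lemma one_minus_power_log_concave:
  fixes q :: real
  assumes q: "0 < q" "q < 1" and x: "0 < x" "x \<le> y" and le: "x * z \<le> y\<^sup>2"
  shows "(1 - q ^ x) * (1 - q ^ z) \<le> (1 - q ^ y) ^ 2"
proof -
  define l where "l = real y / real x"
  define s t where "s = q ^ x" and "t = q ^ y"
  define f where "f = (\<lambda>u :: real. u powr l)"
  have l: "l \<ge> 1" using x by (simp add: l_def)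
  have st: "0 < t" "t \<le> s" "s < 1" 
    using q x by (auto simp: s_def t_def power_decreasing power_less_one_iff)
  have fs: "f s = t"
    using q x by (simp add: f_def s_def t_def l_def powr_realpow[symmetric] powr_powr)
  have ft: "f t = q powr (real y ^ 2 / real x)"
    using q x by (simp add: f_def t_def l_def powr_realpow[symmetric] powr_powr power2_eq_square)
  have slope: "(f t - f 1) / (t - 1) \<le> (f s - f 1) / (s - 1)"
  proof (cases "t = s")
    case False
    then show ?thesis
      using convex_on_slope_le(2)[OF powr_convex[OF l], of t 1 s] st by (simp add: f_def)
  qed simp
  have "real x * real z \<le> real y ^ 2"
    using le by (metis of_nat_le_iff of_nat_mult of_nat_power)
  hence "real z \<le> real y ^ 2 / real x"
    using x by (simp add: pos_le_divide_eq mult.commute)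
  hence "f t \<le> q ^ z"
    using q by (simp add: ft powr_mono' flip: powr_realpow)
  hence "(1 - q ^ z) * (1 - s) \<le> (1 - f t) * (1 - s)"
    using st by (intro mult_right_mono) auto
  also have "\<dots> \<le> (1 - t) * (1 - t)"
    using slope st fs by (simp add: f_def divide_simps mult.commute split: if_splits) (simp add: algebra_simps)
  finally show ?thesis by (simp add: s_def t_def power2_eq_square mult.commute)
qed

lemma log_concave_seq_mult:
  assumes "log_concave_seq a" "log_concave_seq b" "\<And>j. 0 \<le> a j" "\<And>j. 0 \<le> b j"
  shows "log_concave_seq (\<lambda>j. a j * b j)"
  unfolding log_concave_seq_def
proof (intro allI impI)
  fix j :: nat assume "1 \<le> j"
  hence "(a (j - 1) * a (j + 1)) * (b (j - 1) * b (j + 1)) \<le> (a j)\<^sup>2 * (b j)\<^sup>2"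
    using assms by (intro mult_mono) (auto simp: log_concave_seq_def)
  thus "a (j - 1) * b (j - 1) * (a (j + 1) * b (j + 1)) \<le> (a j * b j)\<^sup>2"
    by (simp add: power_mult_distrib mult_ac)
qed

text \<open>
  Log-concavity makes successive ratios decrease, so once a ratio is below one it stays there. The
  condition on zeros excludes sequences such as \<open>1, 0, 0, 1\<close>, which are log-concave and still
  rise again after a gap.
\<close>

lemma log_concave_imp_unimodal:
  assumes lc: "log_concave_seq c" and nonneg: "\<And>j. 0 \<le> c j"
    and zeros: "\<And>i j. c i = 0 \<Longrightarrow> i < j \<Longrightarrow> c j = 0"
  shows "unimodal_seq c"
  unfolding unimodal_seq_def
proof (intro allI impI, elim conjE)
  fix i j :: nat assume "i < j" and drop: "c (i + 1) < c i"
  have "c (i + k + 1) \<le> c (i + k)" for k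
  proof (induction k)
    case (Suc k)
    show ?case
    proof (cases "c (i + k) = 0")
      case True
      then show ?thesis using zeros[of "i + k"] by simp
    next
      case False
      hence pos: "0 < c (i + k)" using nonneg[of "i + k"] by linarith
      have "c (i + k) * c (i + k + 2) \<le> c (i + k + 1) * c (i + k + 1)"
        using lc[unfolded log_concave_seq_def, rule_format, of "i + k + 1"]
        by (simp add: power2_eq_square)
      also have "\<dots> \<le> c (i + k) * c (i + k + 1)"
        using Suc nonneg by (intro mult_right_mono) auto
      finally show ?thesis using pos by simp
    qed
  qed (use drop in simp)
  from this[of "j - i"] \<open>i < j\<close> show "c (j + 1) \<le> c j" by simp
qed

section \<open>The expected Hilbert function\<close>

lemma set_pmf_random_subset: "set_pmf (random_subset M p) \<subseteq> Pow M"
  by (auto simp: random_subset_def)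

text \<open>
  A monomial \<open>x\<^sup>k\<close> of degree \<open>j\<close> contributes to \<open>h\<^sub>j\<close> when the random set hits the set \<open>N k\<close> of its
  multiples of degree \<open>D\<close>. In degrees above \<open>D\<close> there are no such multiples.
\<close>

lemma expectation_hilbert_function:
  fixes p q :: real
  assumes p: "0 \<le> p" "p \<le> 1" "q = 1 - p"
  shows "measure_pmf.expectation (random_subset (Mon D :: ('n::finite, 'k::field) mpoly set) p)
      (\<lambda>B. real (hilbert_function B j))
    = real ((j + CARD('n) - 1) choose (CARD('n) - 1))
      * (if j \<le> D then 1 - q ^ ((D - j + CARD('n) - 1) choose (CARD('n) - 1)) else 0)"
proof -
  let ?R = "random_subset (Mon D :: ('n, 'k) mpoly set) p"
  define E where "E = {k :: 'n \<Rightarrow>\<^sub>0 nat. expdeg k = j}"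
  define N where "N = (\<lambda>k. monomial ` {b. expdeg b = D \<and> divides_exp k b} :: ('n, 'k) mpoly set)"
  have Mon: "Mon D = (monomial ` {b. expdeg b = D} :: ('n, 'k) mpoly set)"
    by (auto simp: Mon_def)
  have finM: "finite (Mon D :: ('n, 'k) mpoly set)"
    by (simp add: Mon finite_exponents_of_degree)
  have finE: "finite E" by (simp add: E_def finite_exponents_of_degree)
  have sub: "N k \<subseteq> Mon D" for k by (auto simp: N_def Mon)
  have cardN: "card (N k) = card {b. expdeg b = D \<and> divides_exp k b}" for k
    unfolding N_def by (intro card_image inj_on_subset[OF inj_monomial subset_UNIV])
  have hit: "1 - (1 - p) ^ card (N k)
      = (if j \<le> D then 1 - q ^ ((D - j + CARD('n) - 1) choose (CARD('n) - 1)) else 0)"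
    if "k \<in> E" for k
  proof (cases "j \<le> D")
    case True
    with that show ?thesis
      by (simp add: cardN E_def card_multiples_of_degree p(3))
  next
    case False
    with that have "{b. expdeg b = D \<and> divides_exp k b} = {}"
      using expdeg_mono[of k] by (auto simp: E_def)
    with False show ?thesis by (simp only: cardN) simp
  qed
  have "hilbert_function B j = card {k \<in> E. B \<inter> N k \<noteq> {}}" if B: "B \<subseteq> Mon D" for B :: "('n, 'k) mpoly set"
  proof -
    have "(\<exists>b. monomial b \<in> B \<and> divides_exp k b) \<longleftrightarrow> B \<inter> N k \<noteq> {}" for k
      using B by (fastforce simp: N_def Mon dest: injD[OF inj_monomial])
    thus ?thesis by (simp add: hilbert_function_eq_card E_def)
  qed
  hence "measure_pmf.expectation ?R (\<lambda>B. real (hilbert_function B j))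
      = measure_pmf.expectation ?R (\<lambda>B. real (card {k \<in> E. B \<inter> N k \<noteq> {}}))"
    using set_pmf_random_subset[of "Mon D :: ('n, 'k) mpoly set" p]
    by (intro integral_cong_AE) (auto simp: AE_measure_pmf_iff)
  also have "\<dots> = (\<Sum>k\<in>E. 1 - (1 - p) ^ card (N k))"
    by (rule expectation_card_hit[OF finM p(1,2) finE sub])
  also have "\<dots> = real (card E)
      * (if j \<le> D then 1 - q ^ ((D - j + CARD('n) - 1) choose (CARD('n) - 1)) else 0)"
    using hit by simp
  finally show ?thesis by (simp add: E_def card_exponents_of_degree)
qed

text \<open>
  Reversal \<open>j \<mapsto> D - j\<close> preserves log-concavity, and at the end of the support, where \<open>j = D\<close>, the
  inequality is trivial because the next entry is zero.
\<close>

lemma hit_probability_log_concave: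
  fixes q :: real
  assumes q: "0 < q" "q < 1" and n: "n \<ge> 1"
  shows "log_concave_seq (\<lambda>j. if j \<le> D then 1 - q ^ ((D - j + n - 1) choose (n - 1)) else 0)"
  unfolding log_concave_seq_def
proof (intro allI impI)
  fix j :: nat assume "1 \<le> j"
  define N where "N = (\<lambda>d. (d + n - 1) choose (n - 1))"
  let ?f = "\<lambda>j. if j \<le> D then 1 - q ^ N (D - j) else 0"
  have "?f (j - 1) * ?f (j + 1) \<le> (?f j)\<^sup>2"
  proof (cases "j + 1 \<le> D")
    case True
    define d where "d = D - (j + 1)"
    have d: "D - (j - 1) = Suc (Suc d)" "D - j = Suc d" "D - (j + 1) = d"
      using True \<open>1 \<le> j\<close> by (auto simp: d_def)
    have "real (N d * N (Suc (Suc d))) \<le> real ((N (Suc d))\<^sup>2)"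
      using binomial_shift_log_concave[OF n, of d] by (simp add: N_def)
    hence "N d * N (Suc (Suc d)) \<le> (N (Suc d))\<^sup>2" by (simp only: of_nat_le_iff)
    moreover have "0 < N d" using n by (simp add: N_def)
    moreover have "N d \<le> N (Suc d)"
      unfolding N_def by (rule binomial_right_mono) simp
    ultimately have "(1 - q ^ N d) * (1 - q ^ N (Suc (Suc d))) \<le> (1 - q ^ N (Suc d))\<^sup>2"
      by (intro one_minus_power_log_concave q)
    moreover have "?f (j - 1) = 1 - q ^ N (Suc (Suc d))" "?f j = 1 - q ^ N (Suc d)"
      "?f (j + 1) = 1 - q ^ N d"
      using True unfolding d by auto
    ultimately show ?thesis by (simp only: mult.commute)
  qed simp
  thus "(if j - 1 \<le> D then 1 - q ^ ((D - (j - 1) + n - 1) choose (n - 1)) else 0)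
      * (if j + 1 \<le> D then 1 - q ^ ((D - (j + 1) + n - 1) choose (n - 1)) else 0)
    \<le> (if j \<le> D then 1 - q ^ ((D - j + n - 1) choose (n - 1)) else 0)\<^sup>2"
    by (simp only: N_def)
qed

theorem theorem4p4:
  fixes D :: nat and p q :: real
  assumes "infinite (UNIV :: 'k::field set)"
    and "D > 0"
    and "0 < p" and "p < 1" and "q = 1 - p"
  shows "(\<forall>j<D.
            measure_pmf.expectation (random_subset (Mon D :: ('n::finite, 'k) mpoly set) p)
              (\<lambda>B. real (hilbert_function B j))
            = real ((j + CARD('n) - 1) choose (CARD('n) - 1))
              * (1 - q ^ ((D - j + CARD('n) - 1) choose (CARD('n) - 1))))
         \<and> log_concave_seq (expected_h_vector TYPE('k) TYPE('n) D p)
         \<and> unimodal_seq (expected_h_vector TYPE('k) TYPE('n) D p)"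
proof (intro conjI allI impI)
  fix j assume "j < D"
  thus "measure_pmf.expectation (random_subset (Mon D :: ('n, 'k) mpoly set) p)
      (\<lambda>B. real (hilbert_function B j))
    = real ((j + CARD('n) - 1) choose (CARD('n) - 1))
      * (1 - q ^ ((D - j + CARD('n) - 1) choose (CARD('n) - 1)))"
    using assms by (simp add: expectation_hilbert_function)
next
  note E = expectation_hilbert_function[where 'n = 'n and 'k = 'k and D = D and p = p and q = q,
    OF less_imp_le[OF \<open>0 < p\<close>] less_imp_le[OF \<open>p < 1\<close>] \<open>q = 1 - p\<close>]
  have q: "0 < q" "q < 1" using assms by auto
  have n: "CARD('n) \<ge> 1" by (simp add: Suc_leI)
  define N where "N = (\<lambda>d. (d + CARD('n) - 1) choose (CARD('n) - 1))"
  define f where "f = (\<lambda>j. if j \<le> D then 1 - q ^ N (D - j) else 0)"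
  have c: "expected_h_vector TYPE('k) TYPE('n) D p = (\<lambda>j. real (N j) * f j)"
    by (intro ext) (simp add: expected_h_vector_def E N_def f_def)
  have N_pos: "0 < N j" for j using n by (simp add: N_def)
  have f_pos: "0 < f j \<longleftrightarrow> j \<le> D" and f_nonneg: "0 \<le> f j" for j
    using q N_pos[of "D - j"] by (auto simp: f_def power_less_one_iff power_le_one)
  show lc: "log_concave_seq (expected_h_vector TYPE('k) TYPE('n) D p)"
    unfolding c
  proof (rule log_concave_seq_mult)
    show "log_concave_seq (\<lambda>j. real (N j))"
      unfolding log_concave_seq_def
    proof (intro allI impI)
      fix j :: nat assume "1 \<le> j"
      then obtain i where "j = Suc i" by (cases j) auto
      thus "real (N (j - 1)) * real (N (j + 1)) \<le> (real (N j))\<^sup>2"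
        using binomial_shift_log_concave[OF n, of i] by (simp add: N_def)
    qed
    show "log_concave_seq f"
      unfolding f_def N_def by (rule hit_probability_log_concave[OF q n])
  qed (simp_all add: f_nonneg)
  show "unimodal_seq (expected_h_vector TYPE('k) TYPE('n) D p)"
  proof (rule log_concave_imp_unimodal[OF lc])
    fix i j :: nat
    assume "expected_h_vector TYPE('k) TYPE('n) D p i = 0" "i < j"
    hence "\<not> i \<le> D" using N_pos[of i] f_pos[of i] by (auto simp: c)
    with \<open>i < j\<close> show "expected_h_vector TYPE('k) TYPE('n) D p j = 0"
      by (simp add: c f_def)
  qed (simp add: c f_nonneg)
qed

end
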